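(* Let $n\ge 3$ and let $C_n$ be the cycle on $n$ vertices. The $\chi^+$-chromatic mean of $C_n$ is $$\mu_{\chi^+}(C_n)=\begin{cases}\frac{3}{2}, & \text{if } n \text{ is even},\\ \frac{5n-3}{2n}, & \text{if } n \text{ is odd},\end{cases}$$ and the $\chi^+$-chromatic variance of $C_n$ is $$\sigma^2_{\chi^+}(C_n)=\begin{cases}\frac{1}{4}, & \text{if } n \text{ is even},\\ \frac{n^2+8n-9}{4n^2}, & \text{if } n \text{ is odd}.\end{cases}$$
   Context: Graphs are simple, finite, connected and non-trivial (at least two vertices). A proper $k$-colouring $\mathcal{C}=\{c_1,\ldots,c_k\}$ of a graph $G$ assigns one of the colours $c_1,\ldots,c_k$ to each vertex so that adjacent vertices have different colours, every colour being used. Let $\theta(c_i)$ be the number of vertices with colour $c_i$, so $\sum_{i=1}^k\theta(c_i)=|V(G)|$. The colouring sum is $\omega_{\mathcal{C}}(G)=\sum_{i=1}^k i\,\theta(c_i)$. The colouring mean is $\mu_{\mathcal{C}}(G)=\frac{\sum_{i=1}^k i\,\theta(c_i)}{\sum_{i=1}^k\theta(c_i)}$ and the colouring variance is $\sigma^2_{\mathcal{C}}(G)=\frac{\sum_{i=1}^k i^2\,\theta(c_i)}{\sum_{i=1}^k\theta(c_i)}-\left(\frac{\sum_{i=1}^k i\,\theta(c_i)}{\sum_{i=1}^k\theta(c_i)}\right)^2$. The $\chi^+$-chromatic mean $\mu_{\chi^+}(G)$ and $\chi^+$-chromatic variance $\sigma^2_{\chi^+}(G)$ are the colouring mean and colouring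 variance with respect to a proper colouring $\mathcal{C}$ of $G$ with the minimum number $k=\chi(G)$ of colours for which the colouring sum $\omega_{\mathcal{C}}(G)$ is maximum among all proper colourings with $\chi(G)$ colours $c_1,\ldots,c_{\chi(G)}$. *)

theory Defs
  imports Complex_Main "Graph_Theory.Graph_Theory"
begin

text \<open>
  As in the Graph_Theory library, a finite simple graph is a symmetric loop-free digraph
  (\<^locale>\<open>pair_graph\<close>): an edge between u and v is the pair of arcs (u, v) and (v, u).
\<close>

text \<open>The colour $c_i$ is represented by its index i; colours of non-vertices are irrelevant.\<close>

definition proper_colouring :: "'a pair_pre_digraph \<Rightarrow> nat \<Rightarrow> ('a \<Rightarrow> nat) \<Rightarrow> bool" where
  "proper_colouring G k C \<longleftrightarrow>
     C ` pverts G = {1..k} \<and> (\<forall>(u, v) \<in> parcs G. C u \<noteq> C v)"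

definition chromatic_number :: "'a pair_pre_digraph \<Rightarrow> nat" where
  "chromatic_number G = (LEAST k. \<exists>C. proper_colouring G k C)"

definition colour_weight :: "'a pair_pre_digraph \<Rightarrow> ('a \<Rightarrow> nat) \<Rightarrow> nat \<Rightarrow> nat" where
  "colour_weight G C i = card {v \<in> pverts G. C v = i}"

definition colouring_sum :: "'a pair_pre_digraph \<Rightarrow> nat \<Rightarrow> ('a \<Rightarrow> nat) \<Rightarrow> nat" where
  "colouring_sum G k C = (\<Sum>i=1..k. i * colour_weight G C i)"

definition colouring_mean :: "'a pair_pre_digraph \<Rightarrow> nat \<Rightarrow> ('a \<Rightarrow> nat) \<Rightarrow> real" where
  "colouring_mean G k C =
     (\<Sum>i=1..k. real i * real (colour_weight G C i)) / (\<Sum>i=1..k. real (colour_weight G C i))"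

definition colouring_variance :: "'a pair_pre_digraph \<Rightarrow> nat \<Rightarrow> ('a \<Rightarrow> nat) \<Rightarrow> real" where
  "colouring_variance G k C =
     (\<Sum>i=1..k. (real i)\<^sup>2 * real (colour_weight G C i)) / (\<Sum>i=1..k. real (colour_weight G C i))
     - ((\<Sum>i=1..k. real i * real (colour_weight G C i)) / (\<Sum>i=1..k. real (colour_weight G C i)))\<^sup>2"

definition chi_plus_colouring :: "'a pair_pre_digraph \<Rightarrow> ('a \<Rightarrow> nat) \<Rightarrow> bool" where
  "chi_plus_colouring G C \<longleftrightarrow>
     proper_colouring G (chromatic_number G) C \<and>
     (\<forall>C'. proper_colouring G (chromatic_number G) C' \<longrightarrow>
        colouring_sum G (chromatic_number G) C' \<le> colouring_sum G (chromatic_number G) C)"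

text \<open>
  The mean does not depend on which maximising colouring is chosen; the variance may, for a
  general graph. Since nothing is known about the choice made by SOME, the value for a given
  graph can only be established by establishing it for every maximising colouring.
\<close>

definition chi_plus_mean :: "'a pair_pre_digraph \<Rightarrow> real" where
  "chi_plus_mean G = colouring_mean G (chromatic_number G) (SOME C. chi_plus_colouring G C)"

definition chi_plus_variance :: "'a pair_pre_digraph \<Rightarrow> real" where
  "chi_plus_variance G = colouring_variance G (chromatic_number G) (SOME C. chi_plus_colouring G C)"

definition cycle_graph :: "nat \<Rightarrow> nat pair_pre_digraph" where
  "cycle_graph n =
     \<lparr> pverts = {0..<n},
       parcs = {(i, j). i < n \<and> j < n \<and> (j = (i + 1) mod n \<or> i = (j + 1) mod n)} \<rparr>"

lemma cycle_graph_pair_graph: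
  assumes "n \<ge> 3"
  shows "pair_graph (cycle_graph n)"
proof -
  have fin: "finite (parcs (cycle_graph n))"
    by (rule finite_subset[of _ "{0..<n} \<times> {0..<n}"]) (auto simp: cycle_graph_def)
  have sym: "symmetric (with_proj (cycle_graph n))"
    by (auto simp: cycle_graph_def symmetric_def sym_def)
  show ?thesis
  proof
    show "finite (parcs (cycle_graph n))" by (fact fin)
    show "symmetric (with_proj (cycle_graph n))" by (fact sym)
  qed (use assms in \<open>auto simp: cycle_graph_def mod_Suc split: if_splits\<close>)
qed

lemma cycle_graph_connected:
  assumes "n \<ge> 3"
  shows "connected (with_proj (cycle_graph n))"
proof -
  interpret pair_graph "cycle_graph n" using assms by (rule cycle_graph_pair_graph)
  let ?R = "parcs (cycle_graph n)"
  have V: "pverts (cycle_graph n) = {0..<n}" by (simp add: cycle_graph_def)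
  have up: "(0, v) \<in> rtrancl_on {0..<n} ?R \<and> (v, 0) \<in> rtrancl_on {0..<n} ?R" if "v < n" for v
    using that
  proof (induction v)
    case 0
    then show ?case by auto
  next
    case (Suc v)
    have "(v, Suc v) \<in> ?R" "(Suc v, v) \<in> ?R"
      using Suc.prems by (auto simp: cycle_graph_def)
    with Suc show ?case
      by (meson Suc_lessD atLeastLessThan_iff rtrancl_on_into_rtrancl_on
          converse_rtrancl_on_into_rtrancl_on zero_le)
  qed
  have "strongly_connected (with_proj (cycle_graph n))"
    using assms up rtrancl_on_trans[of _ 0 "{0..<n}" ?R]
    by (auto simp: strongly_connected_def reachable_def V)
  then show ?thesis
    using reachable_mk_symmetric_eq[OF pair_sym_arcs]
    by (auto simp: connected_def strongly_connected_def)
qed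

lemma (in pair_graph) chi_plus_colouring_exists: "\<exists>C. chi_plus_colouring G C"
proof -
  obtain f where f: "bij_betw f {1..card (pverts G)} (pverts G)"
    using ex_bij_betw_nat_finite_1[OF pair_finite_verts] by auto
  define g where "g = the_inv_into {1..card (pverts G)} f"
  have g: "bij_betw g (pverts G) {1..card (pverts G)}"
    unfolding g_def using f by (rule bij_betw_the_inv_into)
  have "g u \<noteq> g v" if "(u, v) \<in> parcs G" for u v
    using that g pair_no_loops[OF that] wellformed'[OF that]
    by (auto simp: bij_betw_def inj_on_def)
  with g have "proper_colouring G (card (pverts G)) g"
    by (auto simp: proper_colouring_def bij_betw_def)
  then have "\<exists>C. proper_colouring G (chromatic_number G) C"
    unfolding chromatic_number_def
    using LeastI[of "\<lambda>k. \<exists>C. proper_colouring G k C" "card (pverts G)"] by blast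
  then obtain C0 where C0: "proper_colouring G (chromatic_number G) C0" ..
  have bound: "colouring_sum G (chromatic_number G) C
      < Suc (\<Sum>i=1..chromatic_number G. i * card (pverts G))" for C
    unfolding colouring_sum_def colour_weight_def less_Suc_eq_le
    by (intro sum_mono mult_le_mono card_mono pair_finite_verts) auto
  show ?thesis
    using ex_has_greatest_nat[where P = "proper_colouring G (chromatic_number G)"
        and f = "colouring_sum G (chromatic_number G)"] C0 bound
    unfolding chi_plus_colouring_def by blast
qed

end

theory Submission
  imports Defs
begin

text \<open>
  A colour class is an independent set, and an independent set \<open>A\<close> of \<open>C\<^sub>n\<close> is disjoint from its
  rotation by one step; hence every colour class has at most \<open>m = \<lfloor>n/2\<rfloor>\<close> vertices
  (\<open>cycle_colour_weight_le\<close>). The same bound settles everything else.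

  Since the classes partition the vertices, \<open>n \<le> k m\<close> for every proper \<open>k\<close>-colouring, so
  \<open>k \<ge> 2\<close> for even \<open>n\<close> and \<open>k \<ge> 3\<close> for odd \<open>n\<close>; alternating colourings attain these values.
  If \<open>n = 2m\<close>, both classes of any proper 2-colouring must have exactly \<open>m\<close> vertices.
  If \<open>n = 2m + 1\<close>, the colouring sum is \<open>n + \<theta>(c\<^sub>2) + 2 \<theta>(c\<^sub>3) \<le> n + 3m\<close>, with equality
  only for the weights \<open>1, m, m\<close>. Some colouring uses colour 1 only once, and its weights are
  then these, so the maximum is attained and every maximal colouring has the weights \<open>1, m, m\<close>.
  Thus the weights of a maximal colouring, and with them the mean and the variance, do not depend
  on which one is selected.
\<close>

lemma sum_colour_weight:
  assumes "finite (pverts G)" and "proper_colouring G k C"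
  shows "(\<Sum>i=1..k. colour_weight G C i) = card (pverts G)"
proof -
  have "C ` pverts G = {1..k}"
    using assms(2) by (simp add: proper_colouring_def)
  then show ?thesis
    unfolding colour_weight_def
    using card_eq_sum[of "pverts G"] sum.image_gen[OF assms(1), of "\<lambda>_. 1::nat" C]
    by simp
qed

lemma pverts_cycle_graph [simp]: "pverts (cycle_graph n) = {0..<n}"
  by (simp add: cycle_graph_def)

lemma parcs_cycle_graph:
  "(i, j) \<in> parcs (cycle_graph n) \<longleftrightarrow>
     i < n \<and> j < n \<and> (j = (i + 1) mod n \<or> i = (j + 1) mod n)"
  by (simp add: cycle_graph_def)

text \<open>
  Every vertex is adjacent to its successor, so the class and its rotation by one step are
  disjoint subsets of the vertex set; rotation preserves cardinality.
\<close>

lemma cycle_colour_weight_le: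
  assumes "proper_colouring (cycle_graph n) k C"
  shows "colour_weight (cycle_graph n) C i \<le> n div 2"
proof -
  define A where "A = {v \<in> {0..<n}. C v = i}"
  define rot where "rot = (\<lambda>v. (v + 1) mod n)"
  have inj: "inj_on rot A"
    by (auto simp: inj_on_def A_def rot_def mod_Suc split: if_splits)
  have sub: "A \<union> rot ` A \<subseteq> {0..<n}"
    by (auto simp: A_def rot_def)
  have "A \<inter> rot ` A = {}"
  proof (rule ccontr)
    assume "A \<inter> rot ` A \<noteq> {}"
    then obtain v where v: "v \<in> A" "rot v \<in> A" by auto
    then have "(v, rot v) \<in> parcs (cycle_graph n)"
      by (auto simp: parcs_cycle_graph A_def rot_def)
    then have "C v \<noteq> C (rot v)"
      using assms by (auto simp: proper_colouring_def)
    with v show False by (simp add: A_def)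
  qed
  then have "card (A \<union> rot ` A) = card A + card A"
    using inj by (subst card_Un_disjoint) (auto simp: A_def card_image)
  then have "card A + card A \<le> n"
    using card_mono[OF _ sub] by simp
  then show ?thesis
    by (simp add: colour_weight_def A_def)
qed

lemma cycle_vertices_le:
  assumes "proper_colouring (cycle_graph n) k C"
  shows "n \<le> k * (n div 2)"
proof -
  have "n = (\<Sum>i=1..k. colour_weight (cycle_graph n) C i)"
    using sum_colour_weight[OF _ assms] by simp
  also have "\<dots> \<le> (\<Sum>i=1..k. n div 2)"
    by (intro sum_mono cycle_colour_weight_le[OF assms])
  finally show ?thesis by simp
qed

lemma even_cycle_proper_colouring:
  assumes "n \<ge> 3" "even n"
  shows "proper_colouring (cycle_graph n) 2 (\<lambda>v. 1 + v mod 2)"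
proof -
  have "(\<lambda>v. 1 + v mod 2) ` {0..<n} = {1..2}"
  proof
    show "{1..2} \<subseteq> (\<lambda>v. 1 + v mod 2) ` {0..<n}"
    proof
      fix c :: nat assume "c \<in> {1..2}"
      then have "c = 1 + (c - 1) mod 2" "c - 1 \<in> {0..<n}"
        using assms(1) by auto
      then show "c \<in> (\<lambda>v. 1 + v mod 2) ` {0..<n}" by blast
    qed
  qed auto
  moreover have "u mod 2 \<noteq> v mod 2" if "(u, v) \<in> parcs (cycle_graph n)" for u v
    using that assms by (auto simp: parcs_cycle_graph mod_Suc split: if_splits)
  ultimately show ?thesis
    by (auto simp: proper_colouring_def)
qed

text \<open>
  Alternating 2 and 3 fails only across the edge that closes the odd cycle; spending the cheapest
  colour 1 on the last vertex repairs this.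
\<close>

lemma odd_cycle_proper_colouring:
  assumes "n \<ge> 3" "odd n"
  shows "proper_colouring (cycle_graph n) 3 (\<lambda>v. if v = n - 1 then 1 else 2 + v mod 2)"
    (is "proper_colouring _ _ ?C")
proof -
  have "?C ` {0..<n} = {1..3}"
  proof
    show "{1..3} \<subseteq> ?C ` {0..<n}"
    proof
      fix c :: nat assume "c \<in> {1..3}"
      then consider "c = 1" | "c = 2" | "c = 3" by force
      then have "c = ?C (if c = 1 then n - 1 else c - 2)"
        using assms(1) by cases auto
      moreover have "(if c = 1 then n - 1 else c - 2) \<in> {0..<n}"
        using assms(1) \<open>c \<in> {1..3}\<close> by auto
      ultimately show "c \<in> ?C ` {0..<n}" by blast
    qed
  qed auto
  moreover have "?C u \<noteq> ?C v" if "(u, v) \<in> parcs (cycle_graph n)" for u v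
    using that assms by (auto simp: parcs_cycle_graph mod_Suc split: if_splits)
  ultimately show ?thesis
    unfolding proper_colouring_def pverts_cycle_graph by blast
qed

lemma chromatic_number_even_cycle:
  assumes "n \<ge> 3" "even n"
  shows "chromatic_number (cycle_graph n) = 2"
  unfolding chromatic_number_def
proof (rule Least_equality)
  show "\<exists>C. proper_colouring (cycle_graph n) 2 C"
    using even_cycle_proper_colouring[OF assms] by blast
next
  fix k assume "\<exists>C. proper_colouring (cycle_graph n) k C"
  then have "2 * (n div 2) \<le> k * (n div 2)"
    using cycle_vertices_le assms(2) by auto
  then show "2 \<le> k" using assms(1) by auto
qed

lemma chromatic_number_odd_cycle:
  assumes "n \<ge> 3" "odd n"
  shows "chromatic_number (cycle_graph n) = 3"
  unfolding chromatic_number_def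
proof (rule Least_equality)
  show "\<exists>C. proper_colouring (cycle_graph n) 3 C"
    using odd_cycle_proper_colouring[OF assms] by blast
next
  fix k assume "\<exists>C. proper_colouring (cycle_graph n) k C"
  then have "n \<le> k * (n div 2)"
    using cycle_vertices_le by auto
  moreover have "n = 2 * (n div 2) + 1"
    using assms(2) by simp
  ultimately have "2 * (n div 2) < k * (n div 2)" by linarith
  then show "3 \<le> k" by simp
qed

lemma sum_1_to_2: "(\<Sum>i=1..2. f i) = f 1 + f (2::nat)"
  by (simp add: numeral_2_eq_2)

lemma sum_1_to_3: "(\<Sum>i=1..3. f i) = f 1 + f 2 + f (3::nat)"
  by (simp add: numeral_3_eq_3 numeral_2_eq_2)

lemma even_cycle_colour_weights:
  assumes "even n" "proper_colouring (cycle_graph n) 2 C"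
  shows "colour_weight (cycle_graph n) C 1 = n div 2"
    and "colour_weight (cycle_graph n) C 2 = n div 2"
proof -
  have "colour_weight (cycle_graph n) C 1 + colour_weight (cycle_graph n) C 2 = n"
    using sum_colour_weight[OF _ assms(2)] by (simp only: sum_1_to_2) simp
  with cycle_colour_weight_le[OF assms(2), of 1] cycle_colour_weight_le[OF assms(2), of 2]
  show "colour_weight (cycle_graph n) C 1 = n div 2"
    and "colour_weight (cycle_graph n) C 2 = n div 2"
    using assms(1) by linarith+
qed

text \<open>
  Comparison with the colouring that uses colour 1 once gives \<open>\<theta>(c\<^sub>2) + 2 \<theta>(c\<^sub>3) \<ge> 3m\<close>, where
  \<open>m = n div 2\<close>; as both weights are at most \<open>m\<close>, they equal \<open>m\<close>.
\<close>

lemma odd_cycle_chi_plus_colour_weights: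
  assumes "n \<ge> 3" "odd n" "chi_plus_colouring (cycle_graph n) C"
  shows "colour_weight (cycle_graph n) C 1 = 1"
    and "colour_weight (cycle_graph n) C 2 = n div 2"
    and "colour_weight (cycle_graph n) C 3 = n div 2"
proof -
  let ?w = "colour_weight (cycle_graph n)"
  define D where "D = (\<lambda>v. if v = n - 1 then 1 else 2 + v mod 2)"
  have D: "proper_colouring (cycle_graph n) 3 D"
    unfolding D_def using assms(1,2) by (rule odd_cycle_proper_colouring)
  have C: "proper_colouring (cycle_graph n) 3 C"
    and max: "colouring_sum (cycle_graph n) 3 D \<le> colouring_sum (cycle_graph n) 3 C"
    using assms(3) D
    by (auto simp: chi_plus_colouring_def chromatic_number_odd_cycle[OF assms(1,2)])
  have total: "?w B 1 + ?w B 2 + ?w B 3 = n"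
    if "proper_colouring (cycle_graph n) 3 B" for B
    using sum_colour_weight[OF _ that] by (simp only: sum_1_to_3) simp
  have "{v \<in> {0..<n}. D v = 1} = {n - 1}"
    using assms(1) by (auto simp: D_def)
  then have D1: "?w D 1 = 1"
    by (simp add: colour_weight_def)
  have n: "n = 2 * (n div 2) + 1"
    using assms(2) by simp
  have D23: "?w D 2 = n div 2" "?w D 3 = n div 2"
    using total[OF D] D1 n cycle_colour_weight_le[OF D, of 2] cycle_colour_weight_le[OF D, of 3]
    by linarith+
  have "?w D 1 + 2 * ?w D 2 + 3 * ?w D 3 \<le> ?w C 1 + 2 * ?w C 2 + 3 * ?w C 3"
    using max unfolding colouring_sum_def sum_1_to_3 by simp
  with D1 D23 n total[OF C] cycle_colour_weight_le[OF C, of 2] cycle_colour_weight_le[OF C, of 3]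
  show "?w C 1 = 1" "?w C 2 = n div 2" "?w C 3 = n div 2"
    by linarith+
qed

theorem proposition2p14:
  fixes n :: nat
  assumes "n \<ge> 3"
  shows "chi_plus_mean (cycle_graph n) =
           (if even n then 3 / 2 else (5 * real n - 3) / (2 * real n)) \<and>
         chi_plus_variance (cycle_graph n) =
           (if even n then 1 / 4 else ((real n)\<^sup>2 + 8 * real n - 9) / (4 * (real n)\<^sup>2))"
proof -
  define C where "C = (SOME C. chi_plus_colouring (cycle_graph n) C)"
  have C: "chi_plus_colouring (cycle_graph n) C"
    unfolding C_def
    using pair_graph.chi_plus_colouring_exists[OF cycle_graph_pair_graph[OF assms]]
    by (rule someI_ex)
  define m where "m = real (n div 2)"
  have m: "m > 0" using assms by (simp add: m_def)
  show ?thesis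
  proof (cases "even n")
    case True
    note k = chromatic_number_even_cycle[OF assms True]
    have "proper_colouring (cycle_graph n) 2 C"
      using C by (simp add: chi_plus_colouring_def k)
    note w = even_cycle_colour_weights[OF True this]
    have "chi_plus_mean (cycle_graph n) = (m + 2 * m) / (m + m)"
      unfolding chi_plus_mean_def colouring_mean_def C_def[symmetric] k sum_1_to_2 w m_def
      by simp
    moreover have "chi_plus_variance (cycle_graph n)
        = (m + 4 * m) / (m + m) - ((m + 2 * m) / (m + m))\<^sup>2"
      unfolding chi_plus_variance_def colouring_variance_def C_def[symmetric] k sum_1_to_2 w m_def
      by simp
    ultimately show ?thesis
      using True m by (simp add: field_simps power2_eq_square)
  next
    case False
    note k = chromatic_number_odd_cycle[OF assms False]
    note w = odd_cycle_chi_plus_colour_weights[OF assms False C]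
    have "n = 2 * (n div 2) + 1"
      using False by simp
    then have n: "real n = 2 * m + 1"
      unfolding m_def by linarith
    have "chi_plus_mean (cycle_graph n) = (1 + 2 * m + 3 * m) / (1 + m + m)"
      unfolding chi_plus_mean_def colouring_mean_def C_def[symmetric] k sum_1_to_3 w m_def
      by simp
    then have mean: "chi_plus_mean (cycle_graph n) = (5 * m + 1) / real n"
      by (simp add: n algebra_simps)
    have "chi_plus_variance (cycle_graph n)
        = (1 + 4 * m + 9 * m) / (1 + m + m) - ((1 + 2 * m + 3 * m) / (1 + m + m))\<^sup>2"
      unfolding chi_plus_variance_def colouring_variance_def C_def[symmetric] k sum_1_to_3 w m_def
      by simp
    then have var: "chi_plus_variance (cycle_graph n)
        = (13 * m + 1) / real n - ((5 * m + 1) / real n)\<^sup>2"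
      by (simp add: n algebra_simps)
    have m_eq: "m = (real n - 1) / 2"
      using n by simp
    have "real n > 0" using assms by simp
    then show ?thesis
      unfolding mean var m_eq using False
      by (simp add: field_simps power2_eq_square)
  qed
qed

end
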